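(* Let $\underline{\mathsf{Cyl}}=(\mathsf{Cyl},i_0,i_1,p)$ be a cylinder in a formal category $\mathcal A$ equipped with a contraction structure $p$. Let $j:a_0\to a_1$ be an arrow of $\mathcal A$ which admits a strong deformation retraction $r:a_1\to a_0$ with respect to $\underline{\mathsf{Cyl}}$, and let $f:a_2\to a_3$ be an arrow of $\mathcal A$ which is a normally cloven fibration with respect to $\underline{\mathsf{Cyl}}$. Then for any arrows $g_0:a_0\to a_2$ and $g_1:a_1\to a_3$ of $\mathcal A$ such that $f\circ g_0=g_1\circ j$, there is an arrow $l:a_1\to a_2$ of $\mathcal A$ such that $l\circ j=g_0$ and $f\circ l=g_1$.
   Context: Formal categories. Let $\mathcal C$ be a strict 2-category with a final object $1$. For an object $\mathcal A$ of $\mathcal C$, an object of $\mathcal A$ is a 1-arrow $1\to\mathcal A$ and an arrow of $\mathcal A$ is a 2-arrow between such; composition, commutative diagrams, pushouts and pullbacks in $\mathcal A$ are those of the category $\mathrm{Hom}_{\mathcal C}(1,\mathcal A)$. For 1-arrows $F,F_0,F_1:\mathcal A\to\mathcal A$, a 2-arrow $\eta:F_0\to F_1$, an object $a$ and an arrow $f$ of $\mathcal A$: $F(a)=F\circ a$, $F(f)$ is the whiskering of $F$ and $f$, $\eta(a):F_0(a)\to F_1(a)$ is the whiskering of $\eta$ and $a$. Standing assumption: for all objects $\mathcal A_0,\mathcal A_1$ of $\mathcal C$ and objects $a$ of $\mathcal A_0$, evaluation at $a$ sends pushout (resp. pullback) squares of $\mathrm{Hom}_{\mathcal C}(\mathcal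 A_0,\mathcal A_1)$ to pushout (resp. pullback) squares of $\mathcal A_1$. (For $\mathcal C$ the 2-category of categories these are ordinary categories, functors and natural transformations.) $\mathcal A$ is a fixed object of $\mathcal C$. A cylinder in $\mathcal A$ is a 1-arrow $\mathsf{Cyl}:\mathcal A\to\mathcal A$ with 2-arrows $i_0,i_1:\mathrm{id}_{\mathcal A}\to\mathsf{Cyl}$; a contraction structure is a 2-arrow $p:\mathsf{Cyl}\to\mathrm{id}_{\mathcal A}$ with $pi_0=pi_1=\mathrm{id}$. $r:a_1\to a_0$ is a strong deformation retraction of $j:a_0\to a_1$ with respect to $\underline{\mathsf{Cyl}}$ if $rj=\mathrm{id}(a_0)$ and there is $h:\mathsf{Cyl}(a_1)\to a_1$ with $h\circ i_0(a_1)=jr$, $h\circ i_1(a_1)=\mathrm{id}(a_1)$ and $h\circ\mathsf{Cyl}(j)=j\circ p(a_0)$. Normally cloven fibration with respect to $\underline{\mathsf{Cyl}}$: $f:a_1\to a_2$ for which one can choose, for every object $a_0$ and all $g:a_0\to a_1$, $h:\mathsf{Cyl}(a_0)\to a_2$ with $h\circ i_0(a_0)=f\circ g$, an arrow $l_{a_0}(g,h):\mathsf{Cyl}(a_0)\to a_1$ with $l_{a_0}(g,h)\circ i_0(a_0)=g$ and $f\circ l_{a_0}(g,h)=h$, such that (i) $l_{a_0}(g,f\circ g\circ p(a_0))=g\circ p(a_0)$, and (ii) $l_{a_{-1}}(g\circ u,h\circ\mathsf{Cyl}(u))=l_{a_0}(g,h)\circ\mathsf{Cyl}(u)$ for all $u:a_{-1}\to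 a_0$. *)

theory Defs
  imports Main
begin

text \<open>Composition is written in applicative order: \<open>g \<cdot> f\<close> is \<open>f\<close> followed by \<open>g\<close>.\<close>

record ('a, 'b) cat =
  Obj :: "'a set"
  Arr :: "'b set"
  Dom :: "'b \<Rightarrow> 'a"
  Cod :: "'b \<Rightarrow> 'a"
  Ident :: "'a \<Rightarrow> 'b"
  Comp :: "'b \<Rightarrow> 'b \<Rightarrow> 'b"  (infixr "\<cdot>\<index>" 70)

definition hom :: "('a, 'b, 'z) cat_scheme \<Rightarrow> 'a \<Rightarrow> 'a \<Rightarrow> 'b set" where
  "hom C a b = {f \<in> Arr C. Dom C f = a \<and> Cod C f = b}"

locale category =
  fixes C :: "('a, 'b, 'z) cat_scheme" (structure)
  assumes Dom_closed: "f \<in> Arr C \<Longrightarrow> Dom C f \<in> Obj C"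
    and Cod_closed: "f \<in> Arr C \<Longrightarrow> Cod C f \<in> Obj C"
    and Id_closed: "a \<in> Obj C \<Longrightarrow> Ident C a \<in> hom C a a"
    and Comp_closed: "\<lbrakk>f \<in> hom C a b; g \<in> hom C b c\<rbrakk> \<Longrightarrow> g \<cdot> f \<in> hom C a c"
    and Id_left: "f \<in> hom C a b \<Longrightarrow> Ident C b \<cdot> f = f"
    and Id_right: "f \<in> hom C a b \<Longrightarrow> f \<cdot> Ident C a = f"
    and Comp_assoc: "\<lbrakk>f \<in> hom C a b; g \<in> hom C b c; k \<in> hom C c d\<rbrakk>
      \<Longrightarrow> (k \<cdot> g) \<cdot> f = k \<cdot> (g \<cdot> f)"

definition pushout_square ::
    "('a, 'b, 'z) cat_scheme \<Rightarrow> 'b \<Rightarrow> 'b \<Rightarrow> 'b \<Rightarrow> 'b \<Rightarrow> bool" where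
  "pushout_square C f g f' g' \<longleftrightarrow>
    (\<exists>a b c d. f \<in> hom C a b \<and> g \<in> hom C a c \<and> f' \<in> hom C b d \<and> g' \<in> hom C c d \<and>
      f' \<cdot>\<^bsub>C\<^esub> f = g' \<cdot>\<^bsub>C\<^esub> g \<and>
      (\<forall>e. \<forall>u \<in> hom C b e. \<forall>v \<in> hom C c e. u \<cdot>\<^bsub>C\<^esub> f = v \<cdot>\<^bsub>C\<^esub> g \<longrightarrow>
        (\<exists>!w. w \<in> hom C d e \<and> w \<cdot>\<^bsub>C\<^esub> f' = u \<and> w \<cdot>\<^bsub>C\<^esub> g' = v)))"

definition pullback_square ::
    "('a, 'b, 'z) cat_scheme \<Rightarrow> 'b \<Rightarrow> 'b \<Rightarrow> 'b \<Rightarrow> 'b \<Rightarrow> bool" where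
  "pullback_square C f' g' f g \<longleftrightarrow>
    (\<exists>a b c d. f \<in> hom C b a \<and> g \<in> hom C c a \<and> f' \<in> hom C d b \<and> g' \<in> hom C d c \<and>
      f \<cdot>\<^bsub>C\<^esub> f' = g \<cdot>\<^bsub>C\<^esub> g' \<and>
      (\<forall>e. \<forall>u \<in> hom C e b. \<forall>v \<in> hom C e c. f \<cdot>\<^bsub>C\<^esub> u = g \<cdot>\<^bsub>C\<^esub> v \<longrightarrow>
        (\<exists>!w. w \<in> hom C e d \<and> f' \<cdot>\<^bsub>C\<^esub> w = u \<and> g' \<cdot>\<^bsub>C\<^esub> w = v)))"

text \<open>
  \<open>One K\<close> is the category of objects and 1-arrows. \<open>Two K\<close> has the 1-arrows as its objects,
  the 2-arrows as its arrows, and vertical composition as its composition.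
\<close>

record ('o, 'm, 'c) two_cat =
  One :: "('o, 'm) cat"
  Two :: "('m, 'c) cat"
  hcomp :: "'c \<Rightarrow> 'c \<Rightarrow> 'c"  (infixr "\<star>\<index>" 75)

definition src :: "('o, 'm, 'c, 'z) two_cat_scheme \<Rightarrow> 'c \<Rightarrow> 'o" where
  "src K \<alpha> = Dom (One K) (Dom (Two K) \<alpha>)"

definition trg :: "('o, 'm, 'c, 'z) two_cat_scheme \<Rightarrow> 'c \<Rightarrow> 'o" where
  "trg K \<alpha> = Cod (One K) (Dom (Two K) \<alpha>)"

locale strict_2_category =
  fixes K :: "('o, 'm, 'c, 'z) two_cat_scheme" (structure)
  assumes category_One: "category (One K)"
    and category_Two: "category (Two K)"
    and Obj_Two: "Obj (Two K) = Arr (One K)"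
    and parallel_Dom: "\<alpha> \<in> Arr (Two K) \<Longrightarrow>
      Dom (One K) (Cod (Two K) \<alpha>) = Dom (One K) (Dom (Two K) \<alpha>)"
    and parallel_Cod: "\<alpha> \<in> Arr (Two K) \<Longrightarrow>
      Cod (One K) (Cod (Two K) \<alpha>) = Cod (One K) (Dom (Two K) \<alpha>)"
    and hcomp_closed: "\<lbrakk>\<alpha> \<in> hom (Two K) F F'; \<beta> \<in> hom (Two K) G G'; src K \<beta> = trg K \<alpha>\<rbrakk>
      \<Longrightarrow> \<beta> \<star> \<alpha> \<in> hom (Two K) (G \<cdot>\<^bsub>One K\<^esub> F) (G' \<cdot>\<^bsub>One K\<^esub> F')"
    and hcomp_Id: "\<lbrakk>F \<in> hom (One K) A B; G \<in> hom (One K) B D\<rbrakk>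
      \<Longrightarrow> Ident (Two K) G \<star> Ident (Two K) F = Ident (Two K) (G \<cdot>\<^bsub>One K\<^esub> F)"
    and interchange:
      "\<lbrakk>\<alpha> \<in> hom (Two K) F F'; \<alpha>' \<in> hom (Two K) F' F'';
        \<beta> \<in> hom (Two K) G G'; \<beta>' \<in> hom (Two K) G' G''; src K \<beta> = trg K \<alpha>\<rbrakk>
      \<Longrightarrow> (\<beta>' \<cdot>\<^bsub>Two K\<^esub> \<beta>) \<star> (\<alpha>' \<cdot>\<^bsub>Two K\<^esub> \<alpha>) = (\<beta>' \<star> \<alpha>') \<cdot>\<^bsub>Two K\<^esub> (\<beta> \<star> \<alpha>)"
    and hcomp_assoc:
      "\<lbrakk>\<alpha> \<in> Arr (Two K); \<beta> \<in> Arr (Two K); \<gamma> \<in> Arr (Two K);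
        src K \<beta> = trg K \<alpha>; src K \<gamma> = trg K \<beta>\<rbrakk>
      \<Longrightarrow> (\<gamma> \<star> \<beta>) \<star> \<alpha> = \<gamma> \<star> (\<beta> \<star> \<alpha>)"
    and hcomp_unit_left: "\<alpha> \<in> Arr (Two K) \<Longrightarrow>
      Ident (Two K) (Ident (One K) (trg K \<alpha>)) \<star> \<alpha> = \<alpha>"
    and hcomp_unit_right: "\<alpha> \<in> Arr (Two K) \<Longrightarrow>
      \<alpha> \<star> Ident (Two K) (Ident (One K) (src K \<alpha>)) = \<alpha>"

definition Hom :: "('o, 'm, 'c, 'z) two_cat_scheme \<Rightarrow> 'o \<Rightarrow> 'o \<Rightarrow> ('m, 'c) cat" where
  "Hom K A B =
    \<lparr>Obj = hom (One K) A B,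
     Arr = {\<alpha> \<in> Arr (Two K). Dom (Two K) \<alpha> \<in> hom (One K) A B \<and> Cod (Two K) \<alpha> \<in> hom (One K) A B},
     Dom = Dom (Two K),
     Cod = Cod (Two K),
     Ident = Ident (Two K),
     Comp = Comp (Two K)\<rparr>"

text \<open>Finality is meant 2-categorically: each \<open>Hom K A T\<close> is a terminal category.\<close>

definition final_object :: "('o, 'm, 'c, 'z) two_cat_scheme \<Rightarrow> 'o \<Rightarrow> bool" where
  "final_object K T \<longleftrightarrow> T \<in> Obj (One K) \<and>
    (\<forall>A \<in> Obj (One K). (\<exists>!F. F \<in> Obj (Hom K A T)) \<and> (\<exists>!\<alpha>. \<alpha> \<in> Arr (Hom K A T)))"

definition app_obj :: "('o, 'm, 'c, 'z) two_cat_scheme \<Rightarrow> 'm \<Rightarrow> 'm \<Rightarrow> 'm" where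
  "app_obj K F a = F \<cdot>\<^bsub>One K\<^esub> a"

definition app_arr :: "('o, 'm, 'c, 'z) two_cat_scheme \<Rightarrow> 'm \<Rightarrow> 'c \<Rightarrow> 'c" where
  "app_arr K F f = Ident (Two K) F \<star>\<^bsub>K\<^esub> f"

definition component :: "('o, 'm, 'c, 'z) two_cat_scheme \<Rightarrow> 'c \<Rightarrow> 'm \<Rightarrow> 'c" where
  "component K \<eta> a = \<eta> \<star>\<^bsub>K\<^esub> Ident (Two K) a"

text \<open>
  The ambient setting of formal category theory: a formal category is an object \<open>A\<close> of \<open>K\<close>,
  and its underlying category is \<open>Hom K T A\<close>. Evaluation at an object \<open>a\<close> of \<open>A\<^sub>0\<close> is the
  functor from \<open>Hom K A\<^sub>0 A\<^sub>1\<close> to \<open>Hom K T A\<^sub>1\<close> given on arrows by \<open>\<eta> \<mapsto> component K \<eta> a\<close>.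
\<close>

locale formal_category_theory = strict_2_category K
  for K :: "('o, 'm, 'c, 'z) two_cat_scheme" (structure) +
  fixes T :: 'o
  assumes final: "final_object K T"
    and evaluation_pushout:
      "\<lbrakk>A\<^sub>0 \<in> Obj (One K); A\<^sub>1 \<in> Obj (One K); a \<in> Obj (Hom K T A\<^sub>0);
        pushout_square (Hom K A\<^sub>0 A\<^sub>1) \<eta> \<theta> \<eta>' \<theta>'\<rbrakk>
      \<Longrightarrow> pushout_square (Hom K T A\<^sub>1)
            (component K \<eta> a) (component K \<theta> a) (component K \<eta>' a) (component K \<theta>' a)"
    and evaluation_pullback:
      "\<lbrakk>A\<^sub>0 \<in> Obj (One K); A\<^sub>1 \<in> Obj (One K); a \<in> Obj (Hom K T A\<^sub>0);
        pullback_square (Hom K A\<^sub>0 A\<^sub>1) \<eta>' \<theta>' \<eta> \<theta>\<rbrakk>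
      \<Longrightarrow> pullback_square (Hom K T A\<^sub>1)
            (component K \<eta>' a) (component K \<theta>' a) (component K \<eta> a) (component K \<theta> a)"

record ('m, 'c) cylinder =
  Cyl :: 'm
  i0 :: 'c
  i1 :: 'c

record ('m, 'c) contracted_cylinder = "('m, 'c) cylinder" +
  contr :: 'c

definition is_cylinder ::
    "('o, 'm, 'c, 'y) two_cat_scheme \<Rightarrow> 'o \<Rightarrow> ('m, 'c, 'z) cylinder_scheme \<Rightarrow> bool" where
  "is_cylinder K A X \<longleftrightarrow>
    Cyl X \<in> Obj (Hom K A A) \<and>
    i0 X \<in> hom (Hom K A A) (Ident (One K) A) (Cyl X) \<and>
    i1 X \<in> hom (Hom K A A) (Ident (One K) A) (Cyl X)"

definition is_contraction_structure ::
    "('o, 'm, 'c, 'y) two_cat_scheme \<Rightarrow> 'o \<Rightarrow> ('m, 'c, 'z) contracted_cylinder_scheme \<Rightarrow> bool" where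
  "is_contraction_structure K A X \<longleftrightarrow>
    contr X \<in> hom (Hom K A A) (Cyl X) (Ident (One K) A) \<and>
    contr X \<cdot>\<^bsub>Hom K A A\<^esub> i0 X = Ident (Hom K A A) (Ident (One K) A) \<and>
    contr X \<cdot>\<^bsub>Hom K A A\<^esub> i1 X = Ident (Hom K A A) (Ident (One K) A)"

definition strong_deformation_retraction ::
    "('o, 'm, 'c, 'y) two_cat_scheme \<Rightarrow> 'o \<Rightarrow> 'o \<Rightarrow> ('m, 'c, 'z) contracted_cylinder_scheme
      \<Rightarrow> 'm \<Rightarrow> 'm \<Rightarrow> 'c \<Rightarrow> 'c \<Rightarrow> bool" where
  "strong_deformation_retraction K T A X a\<^sub>0 a\<^sub>1 j r \<longleftrightarrow>
    (let \<A> = Hom K T A in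
      j \<in> hom \<A> a\<^sub>0 a\<^sub>1 \<and>
      r \<in> hom \<A> a\<^sub>1 a\<^sub>0 \<and>
      r \<cdot>\<^bsub>\<A>\<^esub> j = Ident \<A> a\<^sub>0 \<and>
      (\<exists>h \<in> hom \<A> (app_obj K (Cyl X) a\<^sub>1) a\<^sub>1.
        h \<cdot>\<^bsub>\<A>\<^esub> component K (i0 X) a\<^sub>1 = j \<cdot>\<^bsub>\<A>\<^esub> r \<and>
        h \<cdot>\<^bsub>\<A>\<^esub> component K (i1 X) a\<^sub>1 = Ident \<A> a\<^sub>1 \<and>
        h \<cdot>\<^bsub>\<A>\<^esub> app_arr K (Cyl X) j = j \<cdot>\<^bsub>\<A>\<^esub> component K (contr X) a\<^sub>0))"

text \<open>The cleavage \<open>l\<close> is a function of the object \<open>x\<close> and of the arrows \<open>g\<close> and \<open>h\<close>.\<close>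

definition normally_cloven_fibration ::
    "('o, 'm, 'c, 'y) two_cat_scheme \<Rightarrow> 'o \<Rightarrow> 'o \<Rightarrow> ('m, 'c, 'z) contracted_cylinder_scheme
      \<Rightarrow> 'm \<Rightarrow> 'm \<Rightarrow> 'c \<Rightarrow> bool" where
  "normally_cloven_fibration K T A X a\<^sub>1 a\<^sub>2 f \<longleftrightarrow>
    (let \<A> = Hom K T A in
      f \<in> hom \<A> a\<^sub>1 a\<^sub>2 \<and>
      (\<exists>l :: 'm \<Rightarrow> 'c \<Rightarrow> 'c \<Rightarrow> 'c.
        (\<forall>x \<in> Obj \<A>. \<forall>g \<in> hom \<A> x a\<^sub>1. \<forall>h \<in> hom \<A> (app_obj K (Cyl X) x) a\<^sub>2.
          h \<cdot>\<^bsub>\<A>\<^esub> component K (i0 X) x = f \<cdot>\<^bsub>\<A>\<^esub> g \<longrightarrow>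
            l x g h \<in> hom \<A> (app_obj K (Cyl X) x) a\<^sub>1 \<and>
            l x g h \<cdot>\<^bsub>\<A>\<^esub> component K (i0 X) x = g \<and>
            f \<cdot>\<^bsub>\<A>\<^esub> l x g h = h) \<and>
        (\<forall>x \<in> Obj \<A>. \<forall>g \<in> hom \<A> x a\<^sub>1.
          l x g (f \<cdot>\<^bsub>\<A>\<^esub> g \<cdot>\<^bsub>\<A>\<^esub> component K (contr X) x) = g \<cdot>\<^bsub>\<A>\<^esub> component K (contr X) x) \<and>
        (\<forall>x \<in> Obj \<A>. \<forall>g \<in> hom \<A> x a\<^sub>1. \<forall>h \<in> hom \<A> (app_obj K (Cyl X) x) a\<^sub>2.
          h \<cdot>\<^bsub>\<A>\<^esub> component K (i0 X) x = f \<cdot>\<^bsub>\<A>\<^esub> g \<longrightarrow>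
            (\<forall>y \<in> Obj \<A>. \<forall>u \<in> hom \<A> y x.
              l y (g \<cdot>\<^bsub>\<A>\<^esub> u) (h \<cdot>\<^bsub>\<A>\<^esub> app_arr K (Cyl X) u)
                = l x g h \<cdot>\<^bsub>\<A>\<^esub> app_arr K (Cyl X) u))))"

end

theory Submission
  imports Defs
begin

text \<open>
  Write \<open>l\<close> for the cleavage of \<open>f\<close> and \<open>h\<close> for the homotopy from \<open>j \<cdot> r\<close> to the identity.
  The homotopy \<open>g\<^sub>1 \<cdot> h\<close> in \<open>a\<^sub>3\<close> starts at \<open>g\<^sub>1 \<cdot> j \<cdot> r = f \<cdot> g\<^sub>0 \<cdot> r\<close>, so it lifts to a
  homotopy \<open>L = l (g\<^sub>0 \<cdot> r) (g\<^sub>1 \<cdot> h)\<close> starting at \<open>g\<^sub>0 \<cdot> r\<close>. The diagonal filler is the end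
  \<open>L \<cdot> i1\<close> of this lift. It lies over \<open>g\<^sub>1\<close> because \<open>h\<close> ends at the identity.

  To see that it restricts to \<open>g\<^sub>0\<close> along \<open>j\<close>, naturality of \<open>i1\<close> reduces the question to the
  end of \<open>L \<cdot> Cyl j\<close>. Compatibility of the cleavage with precomposition makes
  \<open>L \<cdot> Cyl j\<close> the chosen lift of \<open>g\<^sub>1 \<cdot> h \<cdot> Cyl j\<close>
  starting at \<open>g\<^sub>0 \<cdot> r \<cdot> j = g\<^sub>0\<close>. The retraction is strong, so
  \<open>g\<^sub>1 \<cdot> h \<cdot> Cyl j = g\<^sub>1 \<cdot> j \<cdot> p = f \<cdot> g\<^sub>0 \<cdot> p\<close> is a constant homotopy, and normality
  of the cleavage says that its chosen lift is the constant homotopy \<open>g\<^sub>0 \<cdot> p\<close>, which ends at \<open>g\<^sub>0\<close>.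

  Three facts about the 2-category enter: the arrows of \<open>A\<close> form a category
  (\<open>category_Hom\<close>), the components of \<open>i1\<close> are natural (\<open>component_natural\<close>), and
  evaluation at \<open>a\<^sub>0\<close> turns \<open>p \<cdot> i1 = id\<close> into the corresponding identity
  of components (\<open>component_Comp\<close>, \<open>component_Ident\<close>).
\<close>

context strict_2_category
begin

lemma in_hom_Hom_iff:
  "\<alpha> \<in> hom (Hom K A B) F G \<longleftrightarrow>
    \<alpha> \<in> hom (Two K) F G \<and> F \<in> hom (One K) A B \<and> G \<in> hom (One K) A B"
  by (auto simp: hom_def Hom_def)

lemma Hom_simps [simp]:
  "Obj (Hom K A B) = hom (One K) A B"
  "Ident (Hom K A B) = Ident (Two K)"
  "Comp (Hom K A B) = Comp (Two K)"
  by (simp_all add: Hom_def)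

lemma category_Hom: "category (Hom K A B)"
proof -
  interpret Two: category "Two K" by (rule category_Two)
  show ?thesis
  proof
    show "Dom (Hom K A B) f \<in> Obj (Hom K A B)" "Cod (Hom K A B) f \<in> Obj (Hom K A B)"
      if "f \<in> Arr (Hom K A B)" for f
      using that by (simp_all add: Hom_def)
    show "Ident (Hom K A B) a \<in> hom (Hom K A B) a a" if "a \<in> Obj (Hom K A B)" for a
      using that Two.Id_closed[of a] Obj_Two
      unfolding in_hom_Hom_iff by (simp add: hom_def)
  qed (auto simp: in_hom_Hom_iff intro: Two.Comp_closed Two.Id_left Two.Id_right Two.Comp_assoc)
qed

lemma src_in_hom: "\<alpha> \<in> hom (Hom K A B) F G \<Longrightarrow> src K \<alpha> = A"
  unfolding in_hom_Hom_iff by (auto simp: hom_def src_def)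

lemma trg_in_hom: "\<alpha> \<in> hom (Hom K A B) F G \<Longrightarrow> trg K \<alpha> = B"
  unfolding in_hom_Hom_iff by (auto simp: hom_def trg_def)

lemma Ident_in_hom: "F \<in> hom (One K) A B \<Longrightarrow> Ident (Two K) F \<in> hom (Hom K A B) F F"
  using category.Id_closed[OF category_Hom[of A B]] by simp

lemma hcomp_in_hom:
  assumes "\<alpha> \<in> hom (Hom K A B) F F'" "\<beta> \<in> hom (Hom K B D) G G'"
  shows "\<beta> \<star> \<alpha> \<in> hom (Hom K A D) (G \<cdot>\<^bsub>One K\<^esub> F) (G' \<cdot>\<^bsub>One K\<^esub> F')"
  using assms hcomp_closed[of \<alpha> F F' \<beta> G G'] category.Comp_closed[OF category_One]
  unfolding in_hom_Hom_iff
  by (metis assms src_in_hom trg_in_hom)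

lemma component_in_hom:
  assumes "\<eta> \<in> hom (Hom K A B) F G" "a \<in> hom (One K) T A"
  shows "component K \<eta> a \<in> hom (Hom K T B) (app_obj K F a) (app_obj K G a)"
  unfolding component_def app_obj_def
  using hcomp_in_hom[OF Ident_in_hom[OF assms(2)] assms(1)] .

lemma app_arr_in_hom:
  assumes "F \<in> hom (One K) A B" "u \<in> hom (Hom K T A) x y"
  shows "app_arr K F u \<in> hom (Hom K T B) (app_obj K F x) (app_obj K F y)"
  unfolding app_arr_def app_obj_def
  using hcomp_in_hom[OF assms(2) Ident_in_hom[OF assms(1)]] .

lemma app_obj_Ident: "a \<in> hom (One K) T A \<Longrightarrow> app_obj K (Ident (One K) A) a = a"
  using category.Id_left[OF category_One] by (simp add: app_obj_def)

lemma app_arr_Ident: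
  assumes "u \<in> hom (Hom K T A) x y"
  shows "app_arr K (Ident (One K) A) u = u"
  using hcomp_unit_left[of u] trg_in_hom[OF assms] assms
  unfolding in_hom_Hom_iff by (simp add: app_arr_def hom_def)

lemma hcomp_Comp:
  assumes "\<alpha> \<in> hom (Hom K A B) F F'" "\<alpha>' \<in> hom (Hom K A B) F' F''"
    and "\<beta> \<in> hom (Hom K B D) G G'" "\<beta>' \<in> hom (Hom K B D) G' G''"
  shows "(\<beta>' \<cdot>\<^bsub>Two K\<^esub> \<beta>) \<star> (\<alpha>' \<cdot>\<^bsub>Two K\<^esub> \<alpha>) = (\<beta>' \<star> \<alpha>') \<cdot>\<^bsub>Two K\<^esub> (\<beta> \<star> \<alpha>)"
  using assms interchange[of \<alpha> F F' \<alpha>' F'' \<beta> G G' \<beta>' G'']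
    src_in_hom[OF assms(3)] trg_in_hom[OF assms(1)]
  by (simp add: in_hom_Hom_iff)

text \<open>By interchange, both composites are equal to the horizontal composite of \<open>\<eta>\<close> and \<open>u\<close>.\<close>

lemma component_natural:
  assumes \<eta>: "\<eta> \<in> hom (Hom K A B) F G" and u: "u \<in> hom (Hom K T A) x y"
  shows "component K \<eta> y \<cdot>\<^bsub>Two K\<^esub> app_arr K F u = app_arr K G u \<cdot>\<^bsub>Two K\<^esub> component K \<eta> x"
proof -
  interpret AB: category "Hom K A B" by (rule category_Hom)
  interpret TA: category "Hom K T A" by (rule category_Hom)
  have FG: "F \<in> hom (One K) A B" "G \<in> hom (One K) A B"
    and xy: "x \<in> hom (One K) T A" "y \<in> hom (One K) T A"
    using \<eta> u by (simp_all add: in_hom_Hom_iff)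
  have "component K \<eta> y \<cdot>\<^bsub>Two K\<^esub> app_arr K F u = \<eta> \<star> u"
    using hcomp_Comp[OF u Ident_in_hom[OF xy(2)] Ident_in_hom[OF FG(1)] \<eta>]
      AB.Id_right[OF \<eta>] TA.Id_left[OF u]
    by (simp add: component_def app_arr_def)
  moreover have "app_arr K G u \<cdot>\<^bsub>Two K\<^esub> component K \<eta> x = \<eta> \<star> u"
    using hcomp_Comp[OF Ident_in_hom[OF xy(1)] u \<eta> Ident_in_hom[OF FG(2)]]
      AB.Id_left[OF \<eta>] TA.Id_right[OF u]
    by (simp add: component_def app_arr_def)
  ultimately show ?thesis by simp
qed

lemma component_Comp:
  assumes "\<eta> \<in> hom (Hom K A B) F G" "\<theta> \<in> hom (Hom K A B) G H" "a \<in> hom (One K) T A"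
  shows "component K (\<theta> \<cdot>\<^bsub>Two K\<^esub> \<eta>) a = component K \<theta> a \<cdot>\<^bsub>Two K\<^esub> component K \<eta> a"
  using hcomp_Comp[OF Ident_in_hom[OF assms(3)] Ident_in_hom[OF assms(3)] assms(1,2)]
    category.Id_left[OF category_Hom Ident_in_hom[OF assms(3)]]
  by (simp add: component_def)

lemma component_Ident:
  assumes "F \<in> hom (One K) A B" "a \<in> hom (One K) T A"
  shows "component K (Ident (Two K) F) a = Ident (Two K) (app_obj K F a)"
  using hcomp_Id[OF assms(2,1)] by (simp add: component_def app_obj_def)

end

theorem mainTheorem13:
  fixes K :: "('o, 'm, 'c) two_cat"
    and T A :: 'o
    and X :: "('m, 'c) contracted_cylinder"
    and a\<^sub>0 a\<^sub>1 a\<^sub>2 a\<^sub>3 :: 'm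
    and j r f g\<^sub>0 g\<^sub>1 :: 'c
  assumes "formal_category_theory K T"
    and "A \<in> Obj (One K)"
    and "is_cylinder K A X"
    and "is_contraction_structure K A X"
    and "j \<in> hom (Hom K T A) a\<^sub>0 a\<^sub>1"
    and "strong_deformation_retraction K T A X a\<^sub>0 a\<^sub>1 j r"
    and "f \<in> hom (Hom K T A) a\<^sub>2 a\<^sub>3"
    and "normally_cloven_fibration K T A X a\<^sub>2 a\<^sub>3 f"
    and "g\<^sub>0 \<in> hom (Hom K T A) a\<^sub>0 a\<^sub>2"
    and "g\<^sub>1 \<in> hom (Hom K T A) a\<^sub>1 a\<^sub>3"
    and "f \<cdot>\<^bsub>Hom K T A\<^esub> g\<^sub>0 = g\<^sub>1 \<cdot>\<^bsub>Hom K T A\<^esub> j"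
  shows "\<exists>l \<in> hom (Hom K T A) a\<^sub>1 a\<^sub>2.
           l \<cdot>\<^bsub>Hom K T A\<^esub> j = g\<^sub>0 \<and> f \<cdot>\<^bsub>Hom K T A\<^esub> l = g\<^sub>1"
proof -
  interpret formal_category_theory K T by fact
  interpret TA: category "Hom K T A" by (rule category_Hom)
  note assoc = TA.Comp_assoc[unfolded Hom_simps]
    and comp = TA.Comp_closed[unfolded Hom_simps]
    and idr = TA.Id_right[unfolded Hom_simps]
  let ?C = "app_obj K (Cyl X)" and ?F = "app_arr K (Cyl X)"
  let ?i0 = "component K (i0 X)" and ?i1 = "component K (i1 X)" and ?p = "component K (contr X)"
  note j = assms(5) and f = assms(7) and g0 = assms(9) and g1 = assms(10)
  have eq: "f \<cdot>\<^bsub>Two K\<^esub> g\<^sub>0 = g\<^sub>1 \<cdot>\<^bsub>Two K\<^esub> j" using assms(11) by simp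
  have a0: "a\<^sub>0 \<in> hom (One K) T A" and a1: "a\<^sub>1 \<in> hom (One K) T A"
    using j by (simp_all add: in_hom_Hom_iff)
  have C: "Cyl X \<in> hom (One K) A A"
    and i0X: "i0 X \<in> hom (Hom K A A) (Ident (One K) A) (Cyl X)"
    and i1X: "i1 X \<in> hom (Hom K A A) (Ident (One K) A) (Cyl X)"
    using assms(3) by (simp_all add: is_cylinder_def)
  have pX: "contr X \<in> hom (Hom K A A) (Cyl X) (Ident (One K) A)"
    and pi1X: "contr X \<cdot>\<^bsub>Two K\<^esub> i1 X = Ident (Two K) (Ident (One K) A)"
    using assms(4) by (simp_all add: is_contraction_structure_def)
  have idA: "Ident (One K) A \<in> hom (One K) A A"
    using category.Id_closed[OF category_One assms(2)] .
  have i0: "?i0 a \<in> hom (Hom K T A) a (?C a)"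
    and i1: "?i1 a \<in> hom (Hom K T A) a (?C a)"
    and p: "?p a \<in> hom (Hom K T A) (?C a) a" if "a \<in> hom (One K) T A" for a
    using component_in_hom[OF i0X that] component_in_hom[OF i1X that] component_in_hom[OF pX that]
      app_obj_Ident[OF that] by simp_all
  have pi1: "?p a\<^sub>0 \<cdot>\<^bsub>Two K\<^esub> ?i1 a\<^sub>0 = Ident (Two K) a\<^sub>0"
    using component_Comp[OF i1X pX a0] component_Ident[OF idA a0] pi1X app_obj_Ident[OF a0]
    by simp
  have i1_natural: "?i1 a\<^sub>1 \<cdot>\<^bsub>Two K\<^esub> j = ?F j \<cdot>\<^bsub>Two K\<^esub> ?i1 a\<^sub>0"
    using component_natural[OF i1X j] app_arr_Ident[OF j] by simp
  have Fj: "?F j \<in> hom (Hom K T A) (?C a\<^sub>0) (?C a\<^sub>1)"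
    using app_arr_in_hom[OF C j] .
  obtain h where r: "r \<in> hom (Hom K T A) a\<^sub>1 a\<^sub>0" and rj: "r \<cdot>\<^bsub>Two K\<^esub> j = Ident (Two K) a\<^sub>0"
    and h: "h \<in> hom (Hom K T A) (?C a\<^sub>1) a\<^sub>1"
    and h0: "h \<cdot>\<^bsub>Two K\<^esub> ?i0 a\<^sub>1 = j \<cdot>\<^bsub>Two K\<^esub> r"
    and h1: "h \<cdot>\<^bsub>Two K\<^esub> ?i1 a\<^sub>1 = Ident (Two K) a\<^sub>1"
    and hj: "h \<cdot>\<^bsub>Two K\<^esub> ?F j = j \<cdot>\<^bsub>Two K\<^esub> ?p a\<^sub>0"
    using assms(6) by (auto simp: strong_deformation_retraction_def Let_def)
  obtain l where
    lift: "\<And>x g k. \<lbrakk>x \<in> hom (One K) T A; g \<in> hom (Hom K T A) x a\<^sub>2;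
        k \<in> hom (Hom K T A) (?C x) a\<^sub>3; k \<cdot>\<^bsub>Two K\<^esub> ?i0 x = f \<cdot>\<^bsub>Two K\<^esub> g\<rbrakk>
      \<Longrightarrow> l x g k \<in> hom (Hom K T A) (?C x) a\<^sub>2 \<and> f \<cdot>\<^bsub>Two K\<^esub> l x g k = k"
    and normal: "\<And>x g. \<lbrakk>x \<in> hom (One K) T A; g \<in> hom (Hom K T A) x a\<^sub>2\<rbrakk>
      \<Longrightarrow> l x g (f \<cdot>\<^bsub>Two K\<^esub> g \<cdot>\<^bsub>Two K\<^esub> ?p x) = g \<cdot>\<^bsub>Two K\<^esub> ?p x"
    and stable: "\<And>x g k y u. \<lbrakk>x \<in> hom (One K) T A; g \<in> hom (Hom K T A) x a\<^sub>2;
        k \<in> hom (Hom K T A) (?C x) a\<^sub>3; k \<cdot>\<^bsub>Two K\<^esub> ?i0 x = f \<cdot>\<^bsub>Two K\<^esub> g;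
        y \<in> hom (One K) T A; u \<in> hom (Hom K T A) y x\<rbrakk>
      \<Longrightarrow> l y (g \<cdot>\<^bsub>Two K\<^esub> u) (k \<cdot>\<^bsub>Two K\<^esub> ?F u) = l x g k \<cdot>\<^bsub>Two K\<^esub> ?F u"
    using assms(8) unfolding normally_cloven_fibration_def Let_def Hom_simps
    by - (elim conjE exE, rule that, blast+)
  define g k L where "g = g\<^sub>0 \<cdot>\<^bsub>Two K\<^esub> r" and "k = g\<^sub>1 \<cdot>\<^bsub>Two K\<^esub> h" and "L = l a\<^sub>1 g k"
  have g: "g \<in> hom (Hom K T A) a\<^sub>1 a\<^sub>2" and k: "k \<in> hom (Hom K T A) (?C a\<^sub>1) a\<^sub>3"
    unfolding g_def k_def using comp[OF r g0] comp[OF h g1] .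
  have k0: "k \<cdot>\<^bsub>Two K\<^esub> ?i0 a\<^sub>1 = f \<cdot>\<^bsub>Two K\<^esub> g"
    unfolding g_def k_def
    by (simp add: assoc[OF i0[OF a1] h g1] h0 assoc[OF r j g1, symmetric] eq[symmetric]
        assoc[OF r g0 f])
  have L: "L \<in> hom (Hom K T A) (?C a\<^sub>1) a\<^sub>2" and fL: "f \<cdot>\<^bsub>Two K\<^esub> L = k"
    unfolding L_def using lift[OF a1 g k k0] by simp_all
  have gj: "g \<cdot>\<^bsub>Two K\<^esub> j = g\<^sub>0"
    unfolding g_def by (simp add: assoc[OF j r g0] rj idr[OF g0])
  have kj: "k \<cdot>\<^bsub>Two K\<^esub> ?F j = f \<cdot>\<^bsub>Two K\<^esub> g\<^sub>0 \<cdot>\<^bsub>Two K\<^esub> ?p a\<^sub>0"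
    unfolding k_def
    by (simp add: assoc[OF Fj h g1] hj assoc[OF p[OF a0] j g1, symmetric] eq[symmetric]
        assoc[OF p[OF a0] g0 f])
  have Lj: "L \<cdot>\<^bsub>Two K\<^esub> ?F j = g\<^sub>0 \<cdot>\<^bsub>Two K\<^esub> ?p a\<^sub>0"
    using stable[OF a1 g k k0 a0 j] normal[OF a0 g0] by (simp add: gj kj L_def)
  have "(L \<cdot>\<^bsub>Two K\<^esub> ?i1 a\<^sub>1) \<cdot>\<^bsub>Two K\<^esub> j = g\<^sub>0"
    by (simp add: assoc[OF j i1[OF a1] L] i1_natural assoc[OF i1[OF a0] Fj L, symmetric] Lj
        assoc[OF i1[OF a0] p[OF a0] g0] pi1 idr[OF g0])
  moreover have "f \<cdot>\<^bsub>Two K\<^esub> (L \<cdot>\<^bsub>Two K\<^esub> ?i1 a\<^sub>1) = g\<^sub>1"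
    by (simp add: assoc[OF i1[OF a1] L f, symmetric] fL k_def assoc[OF i1[OF a1] h g1] h1
        idr[OF g1])
  ultimately show ?thesis
    using comp[OF i1[OF a1] L] by auto
qed

end
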